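(* Let $E$ be a set and let $\mathcal{C}$ be a collection of pairwise incomparable (with respect to inclusion) finite subsets of $E$. Suppose that $\mathscr{E}(A,B,\mathcal{C})$ holds for every modular pair $A,B\in\mathcal{C}$. Then $\mathscr{E}(A,B,\mathcal{C})$ holds for all pairs $A,B\in\mathcal{C}$.
   Context: For a collection $\mathcal{C}$ of subsets of $E$ and $C_1,C_2\in\mathcal{C}$, the elimination property $\mathscr{E}(C_1,C_2,\mathcal{C})$ means: for every $e\in C_1\cap C_2$ there exists $C_3\in\mathcal{C}$ with $C_3\subseteq (C_1\cup C_2)\setminus\{e\}$. Let $U(\mathcal{C}):=\{\bigcup\mathcal{T}\mid \mathcal{T}\subseteq\mathcal{C}\}$ (all unions of members of $\mathcal{C}$, including $\emptyset$), partially ordered by inclusion. A chain in a poset is a totally ordered subset, and its length is its cardinality minus one; the length $\ell(P)$ of a poset $P$ is the maximum length of a chain in $P$. Two members $A,B\in\mathcal{C}$ form a modular pair if the subposet $\{X\in U(\mathcal{C})\mid X\subseteq A\cup B\}$ of $U(\mathcal{C})$ has length exactly $2$. *)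

theory Defs
  imports Main "HOL-Library.Extended_Nat"
begin

definition elimination :: "'a set \<Rightarrow> 'a set \<Rightarrow> 'a set set \<Rightarrow> bool" where
  "elimination C1 C2 \<C> \<longleftrightarrow>
     (\<forall>e \<in> C1 \<inter> C2. \<exists>C3 \<in> \<C>. C3 \<subseteq> (C1 \<union> C2) - {e})"

definition unions :: "'a set set \<Rightarrow> 'a set set" where
  "unions \<C> = {\<Union>\<T> | \<T>. \<T> \<subseteq> \<C>}"

text \<open>
  Families of sets are regarded as posets under inclusion; \<^const>\<open>chains\<close> are the subfamilies
  totally ordered by inclusion. The truncated subtraction only affects the empty chain, which is
  irrelevant for the length of a nonempty poset.
\<close>

definition chain_length :: "'a set set \<Rightarrow> enat" where
  "chain_length K = (if finite K then enat (card K - 1) else \<infinity>)"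

text \<open>
  If this supremum in \<^typ>\<open>enat\<close> is finite, it is attained, so it is the maximum
  length of a chain.
\<close>

definition poset_length :: "'a set set \<Rightarrow> enat" where
  "poset_length P = (SUP K \<in> chains P. chain_length K)"

definition modular_pair :: "'a set set \<Rightarrow> 'a set \<Rightarrow> 'a set \<Rightarrow> bool" where
  "modular_pair \<C> A B \<longleftrightarrow>
     A \<in> \<C> \<and> B \<in> \<C> \<and> poset_length {X \<in> unions \<C>. X \<subseteq> A \<union> B} = 2"

end

theory Submission
  imports Defs
begin

text \<open>
  Induct on the cardinality of \<open>A \<union> B\<close>. If any two distinct members of the collection inside
  \<open>A \<union> B\<close> have union \<open>A \<union> B\<close>, then every union of members below \<open>A \<union> B\<close> is empty, a member,
  or \<open>A \<union> B\<close>, so the pair is modular. Otherwise two distinct members inside \<open>A \<union> B\<close> have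
  a strictly smaller union. Either one of them avoids \<open>e\<close>, or both contain \<open>e\<close> and the induction
  hypothesis eliminates \<open>e\<close> from them.
\<close>

text \<open>Incomparability lets a chain contain at most one member of \<open>\<C>\<close>; its only
  other possible elements are \<open>{}\<close> and \<open>A \<union> B\<close>, so its length is at
  most 2. The chain \<open>{}\<close>, \<open>A\<close>, \<open>A \<union> B\<close> attains this
  bound.\<close>

lemma modular_pair_if_unions_trivial:
  assumes fin: "finite (A \<union> B)"
    and inc: "pairwise (\<lambda>A B. \<not> A \<subseteq> B \<and> \<not> B \<subseteq> A) \<C>"
    and A: "A \<in> \<C>" and B: "B \<in> \<C>" and "A \<noteq> B"
    and triv: "\<And>C D. C \<in> \<C> \<Longrightarrow> D \<in> \<C> \<Longrightarrow> C \<noteq> D \<Longrightarrow> C \<union> D \<subseteq> A \<union> B \<Longrightarrow> C \<union> D = A \<union> B"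
  shows "modular_pair \<C> A B"
proof -
  let ?P = "{X \<in> unions \<C>. X \<subseteq> A \<union> B}"
  have incomparable: "\<not> A \<subseteq> B" "\<not> B \<subseteq> A"
    using inc A B \<open>A \<noteq> B\<close> by (auto simp: pairwise_def)
  have cases: "X = {} \<or> X = A \<union> B \<or> X \<in> \<C>" if "X \<in> ?P" for X
  proof -
    obtain T where T: "T \<subseteq> \<C>" "X = \<Union>T" "X \<subseteq> A \<union> B"
      using \<open>X \<in> ?P\<close> by (auto simp: unions_def)
    show ?thesis
    proof (cases "\<exists>C\<in>T. \<exists>D\<in>T. C \<noteq> D")
      case True
      then obtain C D where CD: "C \<in> T" "D \<in> T" "C \<noteq> D" by blast
      \<comment> \<open>Two distinct members of \<open>T\<close> already fill
        \<open>A \<union> B\<close>, which squeezes \<open>X\<close> between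
        \<open>C \<union> D\<close> and \<open>A \<union> B\<close>.\<close>
      then have "C \<union> D \<subseteq> X" using T by blast
      then have "C \<union> D = A \<union> B" using triv[of C D] CD T by blast
      then show ?thesis using \<open>C \<union> D \<subseteq> X\<close> T by blast
    next
      case False
      then consider "T = {}" | C where "T = {C}"
        by (metis is_singletonE is_singletonI')
      then show ?thesis using T by cases auto
    qed
  qed
  have upper: "chain_length K \<le> 2" if K: "K \<in> chains ?P" for K
  proof -
    have KP: "K \<subseteq> ?P" and chain: "\<And>C D. C \<in> K \<Longrightarrow> D \<in> K \<Longrightarrow> C \<subseteq> D \<or> D \<subseteq> C"
      using K by (auto simp: chains_def chain_subset_def)
    have "K \<subseteq> Pow (A \<union> B)" using KP by blast
    then have finK: "finite K" using fin by (meson finite_Pow_iff finite_subset)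
    have eq: "C = D" if "C \<in> K \<inter> \<C>" "D \<in> K \<inter> \<C>" for C D
      using chain[of C D] pairwiseD[OF inc, of C D] that by blast
    have "card (K \<inter> \<C>) \<le> 1"
      using eq finK card_le_Suc0_iff_eq[of "K \<inter> \<C>"] by auto
    moreover have "K \<subseteq> {{}, A \<union> B} \<union> (K \<inter> \<C>)" using KP cases by blast
    then have "card K \<le> card ({{}, A \<union> B} \<union> (K \<inter> \<C>))" by (intro card_mono) (use finK in auto)
    moreover have "\<dots> \<le> card {{}, A \<union> B} + card (K \<inter> \<C>)" by (rule card_Un_le)
    moreover have "card {{}, A \<union> B} \<le> 2" by (simp add: card_insert_if)
    ultimately have "card K - 1 \<le> 2" by linarith
    then show ?thesis using finK by (simp add: chain_length_def numeral_eq_enat)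
  qed
  have unionsI: "\<Union>T \<in> unions \<C>" if "T \<subseteq> \<C>" for T
    using that by (auto simp: unions_def)
  have "{} \<in> unions \<C>" "A \<in> unions \<C>" "A \<union> B \<in> unions \<C>"
    using unionsI[of "{}"] unionsI[of "{A}"] unionsI[of "{A, B}"] A B by simp_all
  then have chain: "{{}, A, A \<union> B} \<in> chains ?P"
    by (auto simp: chains_def chain_subset_def)
  \<comment> \<open>Each equality would force a forbidden inclusion: \<open>A \<subseteq> B\<close>
    if \<open>A\<close> were empty, \<open>B \<subseteq> A\<close> if \<open>A\<close> were the
    whole union.\<close>
  have "A \<noteq> {}" "A \<noteq> A \<union> B" using incomparable by auto
  then have "card {{}, A, A \<union> B} = 3" by (auto simp: card_insert_if)
  then have "chain_length {{}, A, A \<union> B} = 2" by (simp add: chain_length_def numeral_eq_enat)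
  then have "2 \<le> poset_length ?P"
    unfolding poset_length_def using chain by (metis (no_types, lifting) SUP_upper)
  moreover have "poset_length ?P \<le> 2"
    unfolding poset_length_def using upper by (rule SUP_least)
  ultimately show ?thesis using A B by (simp add: modular_pair_def)
qed

theorem theorem2p2:
  fixes E :: "'a set" and \<C> :: "'a set set"
  assumes "\<C> \<subseteq> Pow E"
    and "\<forall>A \<in> \<C>. finite A"
    and "pairwise (\<lambda>A B. \<not> A \<subseteq> B \<and> \<not> B \<subseteq> A) \<C>"
    and "\<forall>A \<in> \<C>. \<forall>B \<in> \<C>. modular_pair \<C> A B \<longrightarrow> elimination A B \<C>"
  shows "\<forall>A \<in> \<C>. \<forall>B \<in> \<C>. A \<noteq> B \<longrightarrow> elimination A B \<C>"
proof -
  have "elimination A B \<C>" if "A \<in> \<C>" "B \<in> \<C>" "A \<noteq> B" for A B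
    using that
  proof (induction "card (A \<union> B)" arbitrary: A B rule: less_induct)
    case less
    have fin: "finite (A \<union> B)" using less.prems assms(2) by blast
    show ?case
    proof (cases "\<exists>C\<in>\<C>. \<exists>D\<in>\<C>. C \<noteq> D \<and> C \<union> D \<subset> A \<union> B")
      case True
      then obtain C D where CD: "C \<in> \<C>" "D \<in> \<C>" "C \<noteq> D" "C \<union> D \<subset> A \<union> B" by blast
      \<comment> \<open>\<open>C\<close> and \<open>D\<close> do not depend on \<open>e\<close>, so
        one use of the induction hypothesis serves every \<open>e\<close>.\<close>
      then have elim: "elimination C D \<C>"
        using less.hyps psubset_card_mono[OF fin] by blast
      show ?thesis
        unfolding elimination_def
      proof
        fix e
        assume "e \<in> A \<inter> B"
        show "\<exists>C3\<in>\<C>. C3 \<subseteq> A \<union> B - {e}"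
        proof (cases "e \<in> C \<inter> D")
          case True
          then obtain C3 where "C3 \<in> \<C>" "C3 \<subseteq> C \<union> D - {e}"
            using elim unfolding elimination_def by blast
          then show ?thesis using CD by blast
        next
          case False
          \<comment> \<open>Whichever of \<open>C\<close> and \<open>D\<close> misses
            \<open>e\<close> is itself the required member.\<close>
          then show ?thesis using CD by blast
        qed
      qed
    next
      case False
      have "modular_pair \<C> A B"
        \<comment> \<open>With no proper inclusion possible, a union of two distinct members that
          lies inside \<open>A \<union> B\<close> must equal it.\<close>
        by (rule modular_pair_if_unions_trivial[OF fin assms(3) less.prems]) (use False in blast)
      then show ?thesis using assms(4) less.prems by blast
    qed
  qed
  then show ?thesis by blast
qed

end
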